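(* Let $F$ be a formula in CNF that does not contain the equality predicate. If a clause $C$ is blocked in $F$, then $C$ is redundant with respect to $F$, i.e., $F \setminus \{C\}$ and $F \cup \{C\}$ are satisfiability equivalent.
   Context: First-order logic. A literal is an atom or a negated atom; for a literal $L$, $\bar L$ denotes its complement. A clause is a disjunction of literals, treated as a multiset of literals; a formula in CNF is a finite set of clauses; variables of clauses are implicitly universally quantified, and distinct clauses are assumed to be variable disjoint. A clause is valid if it is true in every interpretation (in the absence of equality, iff it contains a pair of complementary literals). $L$-resolvent: given clauses $C = L \lor C'$ and $D = N_1 \lor \dots \lor N_l \lor D'$ with $l > 0$ (variable disjoint) such that $L, \bar N_1, \dots, \bar N_l$ are unifiable with most general unifier $\sigma$, the clause $C'\sigma \lor D'\sigma$ is an $L$-resolvent of $C$ and $D$. A clause $C$ is blocked by a literal $L \in C$ in a formula $F$ if every $L$-resolvent of $C$ with a clause in $F \setminus \{C\}$ is valid; $C$ is blocked in $F$ if it is blocked by some literal of $C$. Two formulas are satisfiability equivalent if both are satisfiable or both are unsatisfiable.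
   Formalization: The clause C, and not only F, is required to be free of the equality predicate; otherwise the claim fails, e.g. for F empty and C the clause x ≠ x, which is blocked but unsatisfiable. *)

theory Defs
  imports "HOL-Library.Multiset"
begin

section \<open>Syntax\<close>

text \<open>
  A symbol applied to argument lists of different lengths plays the role of different symbols, one
  for each arity. Equality is not one of the predicate symbols; it has its own constructor, so that
  interpretations cannot reinterpret it.
\<close>

datatype ('f, vars_trm: 'v) trm = Var 'v | Fun 'f "('f, 'v) trm list"

datatype ('f, 'p, vars_atom: 'v) atom =
    Pred 'p "('f, 'v) trm list"
  | Eq "('f, 'v) trm" "('f, 'v) trm"

datatype ('f, 'p, vars_literal: 'v) literal =
    Pos (atom_of: "('f, 'p, 'v) atom")
  | Neg (atom_of: "('f, 'p, 'v) atom")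

primrec complement :: "('f, 'p, 'v) literal \<Rightarrow> ('f, 'p, 'v) literal" where
  "complement (Pos A) = Neg A"
| "complement (Neg A) = Pos A"

type_synonym ('f, 'p, 'v) clause = "('f, 'p, 'v) literal multiset"

definition vars_clause :: "('f, 'p, 'v) clause \<Rightarrow> 'v set" where
  "vars_clause C = (\<Union>L \<in> set_mset C. vars_literal L)"

definition variable_disjoint :: "('f, 'p, 'v) clause set \<Rightarrow> bool" where
  "variable_disjoint F \<longleftrightarrow>
     (\<forall>C \<in> F. \<forall>D \<in> F. C \<noteq> D \<longrightarrow> vars_clause C \<inter> vars_clause D = {})"

text \<open>A formula in CNF, under the convention that distinct clauses share no variables.\<close>

definition is_cnf :: "('f, 'p, 'v) clause set \<Rightarrow> bool" where
  "is_cnf F \<longleftrightarrow> finite F \<and> variable_disjoint F"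

definition equality_free :: "('f, 'p, 'v) clause set \<Rightarrow> bool" where
  "equality_free F \<longleftrightarrow> (\<forall>C \<in> F. \<forall>L \<in># C. \<forall>s t. atom_of L \<noteq> Eq s t)"


section \<open>Semantics\<close>

record ('f, 'p, 'd) interp =
  universe :: "'d set"
  fun_interp :: "'f \<Rightarrow> 'd list \<Rightarrow> 'd"
  pred_interp :: "'p \<Rightarrow> 'd list \<Rightarrow> bool"

definition is_interpretation :: "('f, 'p, 'd) interp \<Rightarrow> bool" where
  "is_interpretation I \<longleftrightarrow> universe I \<noteq> {} \<and>
     (\<forall>f ds. set ds \<subseteq> universe I \<longrightarrow> fun_interp I f ds \<in> universe I)"

primrec eval_trm :: "('f, 'p, 'd) interp \<Rightarrow> ('v \<Rightarrow> 'd) \<Rightarrow> ('f, 'v) trm \<Rightarrow> 'd" where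
  "eval_trm I \<beta> (Var x) = \<beta> x"
| "eval_trm I \<beta> (Fun f ts) = fun_interp I f (map (eval_trm I \<beta>) ts)"

primrec eval_atom :: "('f, 'p, 'd) interp \<Rightarrow> ('v \<Rightarrow> 'd) \<Rightarrow> ('f, 'p, 'v) atom \<Rightarrow> bool" where
  "eval_atom I \<beta> (Pred p ts) \<longleftrightarrow> pred_interp I p (map (eval_trm I \<beta>) ts)"
| "eval_atom I \<beta> (Eq s t) \<longleftrightarrow> eval_trm I \<beta> s = eval_trm I \<beta> t"

primrec eval_literal :: "('f, 'p, 'd) interp \<Rightarrow> ('v \<Rightarrow> 'd) \<Rightarrow> ('f, 'p, 'v) literal \<Rightarrow> bool" where
  "eval_literal I \<beta> (Pos A) \<longleftrightarrow> eval_atom I \<beta> A"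
| "eval_literal I \<beta> (Neg A) \<longleftrightarrow> \<not> eval_atom I \<beta> A"

definition true_clause :: "('f, 'p, 'd) interp \<Rightarrow> ('f, 'p, 'v) clause \<Rightarrow> bool" where
  "true_clause I C \<longleftrightarrow> (\<forall>\<beta>. range \<beta> \<subseteq> universe I \<longrightarrow> (\<exists>L \<in># C. eval_literal I \<beta> L))"

definition models :: "('f, 'p, 'd) interp \<Rightarrow> ('f, 'p, 'v) clause set \<Rightarrow> bool" where
  "models I F \<longleftrightarrow> (\<forall>C \<in> F. true_clause I C)"

text \<open>
  HOL cannot quantify over the type of domain elements inside a definition. Satisfiability and
  validity therefore range over all interpretations, with arbitrary nonempty universe, whose
  elements are drawn from the (always infinite) type of terms. This is no restriction: by
  \<open>satisfiable_if_models\<close> and \<open>valid_imp_true_clause\<close> below, interpretations over any other type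
  yield the same notions.
\<close>

definition satisfiable :: "('f, 'p, 'v) clause set \<Rightarrow> bool" where
  "satisfiable F \<longleftrightarrow> (\<exists>I :: ('f, 'p, ('f, 'v) trm) interp. is_interpretation I \<and> models I F)"

definition valid :: "('f, 'p, 'v) clause \<Rightarrow> bool" where
  "valid C \<longleftrightarrow> (\<forall>I :: ('f, 'p, ('f, 'v) trm) interp. is_interpretation I \<longrightarrow> true_clause I C)"

definition sat_equivalent :: "('f, 'p, 'v) clause set \<Rightarrow> ('f, 'p, 'v) clause set \<Rightarrow> bool" where
  "sat_equivalent F G \<longleftrightarrow> (satisfiable F \<longleftrightarrow> satisfiable G)"

definition redundant :: "('f, 'p, 'v) clause \<Rightarrow> ('f, 'p, 'v) clause set \<Rightarrow> bool" where
  "redundant C F \<longleftrightarrow> sat_equivalent (F - {C}) (F \<union> {C})"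


section \<open>Resolution and blocked clauses\<close>

type_synonym ('f, 'v) subst = "'v \<Rightarrow> ('f, 'v) trm"

primrec subst_trm :: "('f, 'v) subst \<Rightarrow> ('f, 'v) trm \<Rightarrow> ('f, 'v) trm" where
  "subst_trm \<sigma> (Var x) = \<sigma> x"
| "subst_trm \<sigma> (Fun f ts) = Fun f (map (subst_trm \<sigma>) ts)"

primrec subst_atom :: "('f, 'v) subst \<Rightarrow> ('f, 'p, 'v) atom \<Rightarrow> ('f, 'p, 'v) atom" where
  "subst_atom \<sigma> (Pred p ts) = Pred p (map (subst_trm \<sigma>) ts)"
| "subst_atom \<sigma> (Eq s t) = Eq (subst_trm \<sigma> s) (subst_trm \<sigma> t)"

primrec subst_literal :: "('f, 'v) subst \<Rightarrow> ('f, 'p, 'v) literal \<Rightarrow> ('f, 'p, 'v) literal" where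
  "subst_literal \<sigma> (Pos A) = Pos (subst_atom \<sigma> A)"
| "subst_literal \<sigma> (Neg A) = Neg (subst_atom \<sigma> A)"

definition subst_clause :: "('f, 'v) subst \<Rightarrow> ('f, 'p, 'v) clause \<Rightarrow> ('f, 'p, 'v) clause" where
  "subst_clause \<sigma> C = image_mset (subst_literal \<sigma>) C"

definition unifier :: "('f, 'v) subst \<Rightarrow> ('f, 'p, 'v) literal set \<Rightarrow> bool" where
  "unifier \<sigma> Ls \<longleftrightarrow> (\<forall>K \<in> Ls. \<forall>L \<in> Ls. subst_literal \<sigma> K = subst_literal \<sigma> L)"

definition mgu :: "('f, 'v) subst \<Rightarrow> ('f, 'p, 'v) literal set \<Rightarrow> bool" where
  "mgu \<sigma> Ls \<longleftrightarrow> unifier \<sigma> Ls \<and>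
     (\<forall>\<tau>. unifier \<tau> Ls \<longrightarrow> (\<exists>\<rho>. \<forall>x. \<tau> x = subst_trm \<rho> (\<sigma> x)))"

text \<open>The multiset \<open>N\<close> collects the literals \<open>N\<^sub>1, \<dots>, N\<^sub>l\<close> of \<open>D\<close> that are resolved upon.\<close>

definition L_resolvent ::
  "('f, 'p, 'v) literal \<Rightarrow> ('f, 'p, 'v) clause \<Rightarrow> ('f, 'p, 'v) clause \<Rightarrow> ('f, 'p, 'v) clause \<Rightarrow> bool"
where
  "L_resolvent L C D R \<longleftrightarrow> vars_clause C \<inter> vars_clause D = {} \<and>
     (\<exists>C' N D' \<sigma>. C = {#L#} + C' \<and> D = N + D' \<and> N \<noteq> {#} \<and>
        mgu \<sigma> (insert L (complement ` set_mset N)) \<and>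
        R = subst_clause \<sigma> C' + subst_clause \<sigma> D')"

definition blocked_by ::
  "('f, 'p, 'v) literal \<Rightarrow> ('f, 'p, 'v) clause \<Rightarrow> ('f, 'p, 'v) clause set \<Rightarrow> bool"
where
  "blocked_by L C F \<longleftrightarrow> L \<in># C \<and> (\<forall>D \<in> F - {C}. \<forall>R. L_resolvent L C D R \<longrightarrow> valid R)"

definition blocked :: "('f, 'p, 'v) clause \<Rightarrow> ('f, 'p, 'v) clause set \<Rightarrow> bool" where
  "blocked C F \<longleftrightarrow> (\<exists>L \<in># C. blocked_by L C F)"


section \<open>Interpretations over the type of terms suffice\<close>

text \<open>
  Every interpretation with an assignment \<open>\<beta>\<close> has a substructure generated by \<open>\<beta>\<close>; representing each
  of its elements by one term denoting it gives an isomorphic interpretation over terms.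
\<close>

lemma term_interpretation:
  fixes I :: "('f, 'p, 'd) interp" and \<beta> :: "'v \<Rightarrow> 'd"
  assumes I: "is_interpretation I" and \<beta>: "range \<beta> \<subseteq> universe I"
  obtains J :: "('f, 'p, ('f, 'v) trm) interp" where
    "is_interpretation J"
    "\<And>C :: ('f, 'p, 'v) clause. true_clause I C \<Longrightarrow> true_clause J C"
    "\<And>C :: ('f, 'p, 'v) clause.
       \<not> (\<exists>L \<in># C. eval_literal I \<beta> L) \<Longrightarrow> \<not> true_clause J C"
proof -
  define e where "e = eval_trm I \<beta>"
  define rep where "rep d = (SOME t. e t = d)" for d
  define J :: "('f, 'p, ('f, 'v) trm) interp" where
    "J = \<lparr>universe = rep ` range e,
          fun_interp = (\<lambda>f ts. rep (fun_interp I f (map e ts))),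
          pred_interp = (\<lambda>p ts. pred_interp I p (map e ts))\<rparr>"
  have e_rep: "e (rep (e t)) = e t" for t
    unfolding rep_def by (rule someI[of "\<lambda>s. e s = e t"]) simp
  have e_Fun: "e (Fun f ts) = fun_interp I f (map e ts)" for f ts
    by (simp add: e_def)
  have e_in: "e t \<in> universe I" for t
  proof (induction t)
    case (Var x)
    then show ?case using \<beta> by (auto simp: e_def)
  next
    case (Fun f ts)
    then have "set (map e ts) \<subseteq> universe I" by auto
    then show ?case unfolding e_Fun using I by (auto simp only: is_interpretation_def)
  qed
  have univ: "universe J = rep ` range e" by (simp add: J_def)
  have inj: "s = t" if "s \<in> universe J" "t \<in> universe J" "e s = e t" for s t
    using that e_rep unfolding univ by auto
  have J: "is_interpretation J"
    unfolding is_interpretation_def univ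
    by (auto simp: J_def e_Fun[symmetric] simp del: map_map)
  have trm: "eval_trm I (e \<circ> \<gamma>) t = e (eval_trm J \<gamma> t) \<and> eval_trm J \<gamma> t \<in> universe J"
    if \<gamma>: "range \<gamma> \<subseteq> universe J" for \<gamma> :: "'v \<Rightarrow> ('f, 'v) trm" and t :: "('f, 'v) trm"
  proof (induction t)
    case (Var x)
    then show ?case using \<gamma> by auto
  next
    case (Fun f ts)
    define us where "us = map (eval_trm J \<gamma>) ts"
    have us: "map (eval_trm I (e \<circ> \<gamma>)) ts = map e us"
      using Fun by (auto simp: us_def comp_def)
    have "eval_trm J \<gamma> (Fun f ts) = rep (e (Fun f us))"
      by (simp add: J_def us_def e_Fun)
    moreover have "eval_trm I (e \<circ> \<gamma>) (Fun f ts) = e (Fun f us)"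
      using us by (simp add: e_Fun)
    ultimately show ?case by (simp add: e_rep univ comp_def)
  qed
  have lit: "eval_literal I (e \<circ> \<gamma>) L = eval_literal J \<gamma> L"
    if \<gamma>: "range \<gamma> \<subseteq> universe J" for \<gamma> :: "'v \<Rightarrow> ('f, 'v) trm" and L :: "('f, 'p, 'v) literal"
  proof -
    have "eval_atom I (e \<circ> \<gamma>) A = eval_atom J \<gamma> A" for A :: "('f, 'p, 'v) atom"
    proof (cases A)
      case (Pred p ts)
      have "map (eval_trm I (e \<circ> \<gamma>)) ts = map e (map (eval_trm J \<gamma>) ts)"
        using trm[OF \<gamma>] by auto
      moreover have "pred_interp J p us = pred_interp I p (map e us)" for us
        by (simp add: J_def)
      ultimately show ?thesis using Pred by (simp del: map_map)
    next
      case (Eq s t)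
      then show ?thesis using trm[OF \<gamma>] inj by auto
    qed
    then show ?thesis by (cases L) auto
  qed
  have 2: "true_clause J C" if "true_clause I C" for C :: "('f, 'p, 'v) clause"
    unfolding true_clause_def
  proof (intro allI impI)
    fix \<gamma> :: "'v \<Rightarrow> ('f, 'v) trm"
    assume \<gamma>: "range \<gamma> \<subseteq> universe J"
    have "range (e \<circ> \<gamma>) \<subseteq> universe I" using e_in by auto
    then have "\<exists>L \<in># C. eval_literal I (e \<circ> \<gamma>) L"
      using that unfolding true_clause_def by blast
    then show "\<exists>L \<in># C. eval_literal J \<gamma> L" using lit[OF \<gamma>] by auto
  qed
  have 3: "\<not> true_clause J C" if "\<not> (\<exists>L \<in># C. eval_literal I \<beta> L)" for C :: "('f, 'p, 'v) clause"
  proof -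
    define \<gamma> where "\<gamma> = rep \<circ> e \<circ> Var"
    have \<gamma>: "range \<gamma> \<subseteq> universe J" by (auto simp: \<gamma>_def univ)
    have "e \<circ> \<gamma> = \<beta>" by (rule ext) (simp add: \<gamma>_def e_rep, simp add: e_def)
    then have "\<not> (\<exists>L \<in># C. eval_literal J \<gamma> L)" using lit[OF \<gamma>] that by auto
    then show ?thesis using \<gamma> unfolding true_clause_def by blast
  qed
  show thesis using that[OF J] 2 3 by blast
qed

lemma satisfiable_if_models:
  fixes I :: "('f, 'p, 'd) interp" and F :: "('f, 'p, 'v) clause set"
  assumes I: "is_interpretation I" and F: "models I F"
  shows "satisfiable F"
proof -
  obtain d where "d \<in> universe I" using I unfolding is_interpretation_def by auto
  then have "range (\<lambda>_ :: 'v. d) \<subseteq> universe I" by auto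
  from term_interpretation[OF I this] obtain J :: "('f, 'p, ('f, 'v) trm) interp" where
    "is_interpretation J"
    "\<And>C :: ('f, 'p, 'v) clause. true_clause I C \<Longrightarrow> true_clause J C"
    by blast
  then show ?thesis using F unfolding satisfiable_def models_def by blast
qed

lemma valid_imp_true_clause:
  fixes I :: "('f, 'p, 'd) interp" and C :: "('f, 'p, 'v) clause"
  assumes I: "is_interpretation I" and C: "valid C"
  shows "true_clause I C"
proof (rule ccontr)
  assume "\<not> true_clause I C"
  then obtain \<beta> where \<beta>: "range \<beta> \<subseteq> universe I" and "\<not> (\<exists>L \<in># C. eval_literal I \<beta> L)"
    unfolding true_clause_def by blast
  with term_interpretation[OF I \<beta>] obtain J :: "('f, 'p, ('f, 'v) trm) interp" where
    "is_interpretation J" "\<not> true_clause J C"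
    by metis
  then show False using C unfolding valid_def by blast
qed

end

theory Submission
  imports Defs
begin

text \<open>
  An equality-free satisfiable formula has a model over the free term algebra, where assignments are
  substitutions. Let \<open>C\<close> be blocked by \<open>L\<close>. Order the models of \<open>F - {C}\<close> over the term algebra by
  the set of atoms to which they give the polarity of \<open>L\<close>. Clauses are finite, so the models are
  closed under unions of chains, and Zorn's lemma yields a maximal one. It satisfies \<open>C\<close>: if an
  instance \<open>C\<tau>\<close> were false, making \<open>L\<tau>\<close> true would, by maximality, falsify an instance
  \<open>D\<rho>\<close> of some \<open>D \<in> F - {C}\<close>. Resolving \<open>C\<close> on \<open>L\<close> with all literals of \<open>D\<close> that \<open>\<rho>\<close> sends to the
  complement of \<open>L\<tau>\<close> gives a resolvent with an instance that is false in the original model,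
  although it is valid.
\<close>

section \<open>Most general unifiers\<close>

lemma subst_trm_cong:
  "(\<And>x. x \<in> vars_trm t \<Longrightarrow> \<sigma> x = \<tau> x) \<Longrightarrow> subst_trm \<sigma> t = subst_trm \<tau> t"
  by (induction t) auto

lemma subst_trm_Var: "subst_trm Var t = t"
  by (induction t) (auto simp: map_idI)

lemma subst_trm_subst_trm:
  "subst_trm \<tau> (subst_trm \<sigma> t) = subst_trm (\<lambda>x. subst_trm \<tau> (\<sigma> x)) t"
  by (induction t) auto

lemma vars_subst_trm: "vars_trm (subst_trm \<sigma> t) = (\<Union>x \<in> vars_trm t. vars_trm (\<sigma> x))"
  by (induction t) auto

lemma finite_vars_trm: "finite (vars_trm t)"
  by (induction t) auto

lemma size_le_size_subst_trm:
  "x \<in> vars_trm t \<Longrightarrow> size (\<tau> x) \<le> size (subst_trm \<tau> t)"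
proof (induction t)
  case (Fun f ts)
  then obtain t where "t \<in> set ts" "size (\<tau> x) \<le> size (subst_trm \<tau> t)" by auto
  then have "size (\<tau> x) \<le> size_list (size \<circ> subst_trm \<tau>) ts"
    by (intro size_list_estimation'[of t]) auto
  then show ?case by (simp add: comp_def)
qed auto

text \<open>If \<open>x\<close> occurred properly inside \<open>t\<close>, the image of
  \<open>t\<close> would be strictly larger than that of \<open>x\<close>.\<close>

lemma occurs_check:
  assumes "\<tau> x = subst_trm \<tau> t" "t \<noteq> Var x"
  shows "x \<notin> vars_trm t"
proof
  assume x: "x \<in> vars_trm t"
  then obtain f ts where t: "t = Fun f ts" using assms(2) by (cases t) auto
  with x obtain s where s: "s \<in> set ts" "x \<in> vars_trm s" by auto
  have "size (\<tau> x) \<le> size_list (size \<circ> subst_trm \<tau>) ts"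
    using s size_le_size_subst_trm[OF s(2), of \<tau>] by (intro size_list_estimation'[of s]) auto
  then have "size (\<tau> x) < size (subst_trm \<tau> t)" by (simp add: t comp_def)
  with assms(1) show False by simp
qed

section \<open>Systems of equations and variable elimination\<close>

definition solves :: "('f, 'v) subst \<Rightarrow> (('f, 'v) trm \<times> ('f, 'v) trm) list \<Rightarrow> bool" where
  "solves \<sigma> E \<longleftrightarrow> (\<forall>(s, t) \<in> set E. subst_trm \<sigma> s = subst_trm \<sigma> t)"

definition most_general_solution ::
  "('f, 'v) subst \<Rightarrow> (('f, 'v) trm \<times> ('f, 'v) trm) list \<Rightarrow> bool"
where
  "most_general_solution \<sigma> E \<longleftrightarrow> solves \<sigma> E \<and>
     (\<forall>\<tau>. solves \<tau> E \<longrightarrow> (\<exists>\<rho>. \<forall>x. \<tau> x = subst_trm \<rho> (\<sigma> x)))"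

definition vars_eqs :: "(('f, 'v) trm \<times> ('f, 'v) trm) list \<Rightarrow> 'v set" where
  "vars_eqs E = (\<Union>(s, t) \<in> set E. vars_trm s \<union> vars_trm t)"

lemma finite_vars_eqs: "finite (vars_eqs E)"
  by (auto simp: vars_eqs_def finite_vars_trm)

abbreviation subst_eqs ::
  "('f, 'v) subst \<Rightarrow> (('f, 'v) trm \<times> ('f, 'v) trm) list \<Rightarrow> (('f, 'v) trm \<times> ('f, 'v) trm) list"
where
  "subst_eqs \<sigma> \<equiv> map (map_prod (subst_trm \<sigma>) (subst_trm \<sigma>))"

text \<open>Once \<open>\<tau>\<close> identifies \<open>x\<close> with \<open>t\<close>, replacing
  \<open>x\<close> by \<open>t\<close> beforehand is invisible to it.\<close>

lemma subst_trm_absorb: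
  assumes "\<tau> x = subst_trm \<tau> t"
  shows "subst_trm \<tau> (subst_trm (Var(x := t)) s) = subst_trm \<tau> s"
  unfolding subst_trm_subst_trm using assms by (intro subst_trm_cong) auto

lemma solves_subst_eqs:
  assumes "\<tau> x = subst_trm \<tau> t"
  shows "solves \<tau> (subst_eqs (Var(x := t)) E) \<longleftrightarrow> solves \<tau> E"
  unfolding solves_def by (auto simp: subst_trm_absorb[of \<tau> x t, OF assms] split: prod.splits)

lemma most_general_solution_eliminate:
  assumes x: "x \<notin> vars_trm t"
    and \<sigma>: "most_general_solution \<sigma> (subst_eqs (Var(x := t)) E)"
  shows "most_general_solution (\<lambda>y. subst_trm \<sigma> ((Var(x := t)) y)) ((Var x, t) # E)"
proof -
  define \<mu> where "\<mu> = (\<lambda>y. subst_trm \<sigma> ((Var(x := t)) y))"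
  have "subst_trm \<mu> t = subst_trm \<sigma> t"
    using x unfolding \<mu>_def by (intro subst_trm_cong) auto
  then have "\<mu> x = subst_trm \<mu> t" by (simp add: \<mu>_def)
  moreover have "solves \<mu> E"
    using \<sigma> unfolding most_general_solution_def solves_def \<mu>_def
    by (auto simp: subst_trm_subst_trm split: prod.splits)
  ultimately have "solves \<mu> ((Var x, t) # E)" by (simp add: solves_def)
  moreover have "\<exists>\<rho>. \<forall>y. \<tau> y = subst_trm \<rho> (\<mu> y)" if "solves \<tau> ((Var x, t) # E)" for \<tau>
  proof -
    have eq: "\<tau> x = subst_trm \<tau> t" and "solves \<tau> E" using that by (auto simp: solves_def)
    with \<sigma> obtain \<rho> where \<rho>: "\<And>y. \<tau> y = subst_trm \<rho> (\<sigma> y)"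
      unfolding most_general_solution_def using solves_subst_eqs[of \<tau> x t E, OF eq] by blast
    have "\<tau> y = subst_trm \<rho> (\<mu> y)" for y
    proof -
      \<comment> \<open>Absorbing the binding of \<open>x\<close> into \<open>\<tau>\<close> lets
        the factorization through \<open>\<sigma>\<close> also serve for \<open>\<mu>\<close>, with
        the same \<open>\<rho>\<close>.\<close>
      have "\<tau> y = subst_trm \<tau> ((Var(x := t)) y)" using eq by simp
      also have "\<dots> = subst_trm \<rho> (\<mu> y)"
        unfolding \<mu>_def subst_trm_subst_trm using \<rho> by (intro subst_trm_cong)
      finally show ?thesis .
    qed
    then show ?thesis by blast
  qed
  ultimately show ?thesis unfolding most_general_solution_def \<mu>_def by blast
qed

text \<open>This makes elimination terminate: \<open>x\<close> disappears for good, since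
  \<open>t\<close> cannot reintroduce it.\<close>

lemma vars_eqs_eliminate:
  assumes "x \<notin> vars_trm t"
  shows "vars_eqs (subst_eqs (Var(x := t)) E) \<subset> vars_eqs ((Var x, t) # E)"
proof -
  have "vars_trm (subst_trm (Var(x := t)) s) \<subseteq> (vars_trm s \<union> vars_trm t) - {x}" for s
    using assms by (auto simp: vars_subst_trm split: if_splits)
  then have "vars_eqs (subst_eqs (Var(x := t)) E) \<subseteq> vars_eqs ((Var x, t) # E) - {x}"
    unfolding vars_eqs_def by fastforce
  moreover have "x \<in> vars_eqs ((Var x, t) # E)" by (simp add: vars_eqs_def)
  ultimately show ?thesis by blast
qed

lemma most_general_solution_cong:
  assumes "\<And>\<sigma>. solves \<sigma> E \<longleftrightarrow> solves \<sigma> E'"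
  shows "most_general_solution \<sigma> E \<longleftrightarrow> most_general_solution \<sigma> E'"
  using assms unfolding most_general_solution_def by simp

text \<open>Unification as well-founded induction. Elimination lowers the number of variables;
  deleting a trivial equation and decomposing do not raise it and shrink the left-hand sides. The
  given solution \<open>\<tau>\<close> rules out failure by clash or occurs check.\<close>

lemma most_general_solution_exists:
  "solves \<tau> E \<Longrightarrow> \<exists>\<sigma>. most_general_solution \<sigma> E"
proof (induction E rule: wf_induct_rule[OF wf_measures[of
        "[\<lambda>E. card (vars_eqs E), size_list (\<lambda>(s, t). size s)]"]])
  case (1 E)
  \<comment> \<open>Asking only for the same solutions and variables as
    \<open>(Var x, t) # E'\<close> covers both orientations of the equation.\<close>
  have eliminate: ?case
    if E: "\<And>\<sigma>. solves \<sigma> E \<longleftrightarrow> solves \<sigma> ((Var x, t) # E')"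
      and vars: "vars_eqs E = vars_eqs ((Var x, t) # E')" and "t \<noteq> Var x" for x t E'
  proof -
    have \<tau>: "\<tau> x = subst_trm \<tau> t" "solves \<tau> E'"
      using E "1.prems" by (auto simp: solves_def)
    then have x: "x \<notin> vars_trm t" using occurs_check \<open>t \<noteq> Var x\<close> by metis
    have "card (vars_eqs (subst_eqs (Var(x := t)) E')) < card (vars_eqs E)"
      unfolding vars by (intro psubset_card_mono finite_vars_eqs vars_eqs_eliminate x)
    moreover have "solves \<tau> (subst_eqs (Var(x := t)) E')"
      using solves_subst_eqs[of \<tau> x t, OF \<tau>(1)] \<tau>(2) by blast
    ultimately obtain \<sigma> where "most_general_solution \<sigma> (subst_eqs (Var(x := t)) E')"
      using "1.IH" by auto
    from most_general_solution_eliminate[OF x this] show ?thesis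
      using most_general_solution_cong[of E, OF E] by blast
  qed
  show ?case
  proof (cases E)
    case Nil
    then have "most_general_solution Var E"
      by (auto simp: most_general_solution_def solves_def)
    then show ?thesis by blast
  next
    case (Cons e E')
    obtain s t where e: "e = (s, t)" by force
    have \<tau>: "subst_trm \<tau> s = subst_trm \<tau> t" "solves \<tau> E'"
      using "1.prems" by (auto simp: solves_def Cons e)
    show ?thesis
    proof (cases s)
      case (Var x)
      show ?thesis
      proof (cases "t = Var x")
        case True
        have "vars_eqs E' \<subseteq> vars_eqs E" by (auto simp: vars_eqs_def Cons)
        then have "card (vars_eqs E') \<le> card (vars_eqs E)"
          by (intro card_mono finite_vars_eqs)
        then have "\<exists>\<sigma>. most_general_solution \<sigma> E'"
          using "1.IH"[of E'] \<tau>(2) by (simp add: Cons e le_less)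
        moreover have "solves \<sigma> E \<longleftrightarrow> solves \<sigma> E'" for \<sigma>
          by (simp add: solves_def Cons e Var True)
        ultimately show ?thesis using most_general_solution_cong[of E E'] by blast
      next
        case False
        then show ?thesis using eliminate[of x t E'] by (simp add: Cons e Var)
      qed
    next
      case s: (Fun f ss)
      show ?thesis
      proof (cases t)
        case (Var x)
        then show ?thesis
          using eliminate[of x s E'] by (force simp: Cons e s solves_def vars_eqs_def)
      next
        case t: (Fun g ts)
        \<comment> \<open>Solvability excludes a clash of symbols or arities, so the equation
          decomposes into its arguments.\<close>
        have fg: "f = g" and ss_ts: "map (subst_trm \<tau>) ss = map (subst_trm \<tau>) ts"
          using \<tau>(1) by (auto simp: s t)
        then have len: "length ss = length ts" by (metis length_map)
        have solves: "solves \<sigma> E \<longleftrightarrow> solves \<sigma> (zip ss ts @ E')" for \<sigma>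
        proof -
          have "map (subst_trm \<sigma>) ss = map (subst_trm \<sigma>) ts \<longleftrightarrow>
              (\<forall>(s, t) \<in> set (zip ss ts). subst_trm \<sigma> s = subst_trm \<sigma> t)"
            using len by (induction ss ts rule: list_induct2) auto
          then show ?thesis by (auto simp: solves_def Cons e s t fg)
        qed
        have "vars_eqs (zip ss ts @ E') = vars_eqs E"
        proof -
          have "(\<Union>(s, t) \<in> set (zip ss ts). vars_trm s \<union> vars_trm t) =
              vars_trm (Fun f ss) \<union> vars_trm (Fun g ts)"
            using len by (induction ss ts rule: list_induct2) auto
          then show ?thesis by (auto simp: vars_eqs_def Cons e s t)
        qed
        moreover have "size_list (\<lambda>(s, t). size s) (zip ss ts @ E') <
            size_list (\<lambda>(s, t). size s) E"
        proof -
          have "size_list (\<lambda>(s, t). size s) (zip ss ts @ E') =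
              size_list size ss + size_list (\<lambda>(s, t). size s) E'"
            using len by (induction ss ts rule: list_induct2) auto
          then show ?thesis by (simp add: Cons e s)
        qed
        ultimately have "\<exists>\<sigma>. most_general_solution \<sigma> (zip ss ts @ E')"
          using "1.IH"[of "zip ss ts @ E'"] "1.prems" solves by auto
        then show ?thesis using most_general_solution_cong[of E, OF solves] by blast
      qed
    qed
  qed
qed

section \<open>From literals to systems of equations\<close>

primrec args_atom :: "('f, 'p, 'v) atom \<Rightarrow> ('f, 'v) trm list" where
  "args_atom (Pred p ts) = ts"
| "args_atom (Eq s t) = [s, t]"

abbreviation args :: "('f, 'p, 'v) literal \<Rightarrow> ('f, 'v) trm list" where
  "args L \<equiv> args_atom (atom_of L)"

lemma subst_atom_eq_imp_length_args:
  "subst_atom \<theta> A = subst_atom \<theta> B \<Longrightarrow> length (args_atom A) = length (args_atom B)"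
  by (cases A; cases B) (auto dest: map_eq_imp_length_eq)

text \<open>A single common instance certifies the same predicate and the same number of arguments,
  so \<open>zip\<close> drops nothing and only the argument equations matter.\<close>

lemma subst_atom_eq_iff_solves:
  assumes "subst_atom \<theta> A = subst_atom \<theta> B"
  shows "subst_atom \<rho> A = subst_atom \<rho> B \<longleftrightarrow> solves \<rho> (zip (args_atom A) (args_atom B))"
proof -
  have "map (subst_trm \<rho>) ss = map (subst_trm \<rho>) ts \<longleftrightarrow> solves \<rho> (zip ss ts)"
    if "length ss = length ts" for ss ts
    using that unfolding solves_def by (induction ss ts rule: list_induct2) auto
  from this[OF subst_atom_eq_imp_length_args[OF assms]] show ?thesis
    using assms by (cases A; cases B) auto
qed

lemma subst_literal_eq_iff_solves:
  assumes "subst_literal \<theta> K = subst_literal \<theta> L"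
  shows "subst_literal \<rho> K = subst_literal \<rho> L \<longleftrightarrow> solves \<rho> (zip (args K) (args L))"
  using assms by (cases K; cases L) (auto dest: subst_atom_eq_iff_solves)

lemma mgu_exists:
  assumes "finite Ls" and \<theta>: "unifier \<theta> Ls"
  shows "\<exists>\<sigma>. mgu \<sigma> Ls"
proof (cases "Ls = {}")
  case True
  then have "mgu Var Ls" by (auto simp: mgu_def unifier_def)
  then show ?thesis by blast
next
  case False
  then obtain K where K: "K \<in> Ls" by blast
  obtain Ks where Ks: "set Ks = Ls" using \<open>finite Ls\<close> finite_list by blast
  \<comment> \<open>Comparing every literal with one fixed \<open>K\<close> suffices, as equality of
    instances is transitive.\<close>
  define E where "E = concat (map (\<lambda>L. zip (args K) (args L)) Ks)"
  have unifier: "unifier \<rho> Ls \<longleftrightarrow> solves \<rho> E" for \<rho>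
  proof -
    have "unifier \<rho> Ls \<longleftrightarrow> (\<forall>L \<in> Ls. subst_literal \<rho> K = subst_literal \<rho> L)"
      using K unfolding unifier_def by metis
    also have "\<dots> \<longleftrightarrow> (\<forall>L \<in> Ls. solves \<rho> (zip (args K) (args L)))"
      using \<theta> K subst_literal_eq_iff_solves[of \<theta> K] unfolding unifier_def by blast
    also have "\<dots> \<longleftrightarrow> solves \<rho> E"
      unfolding E_def solves_def using Ks by auto
    finally show ?thesis .
  qed
  then obtain \<sigma> where "most_general_solution \<sigma> E"
    using \<theta> most_general_solution_exists by blast
  then have "mgu \<sigma> Ls" unfolding mgu_def most_general_solution_def unifier .
  then show ?thesis by blast
qed


section \<open>Interpretations over the term algebra\<close>

abbreviation is_Eq :: "('f, 'p, 'v) atom \<Rightarrow> bool" where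
  "is_Eq A \<equiv> \<exists>s t. A = Eq s t"

text \<open>
  The set \<open>T\<close> consists of the true atoms if \<open>b\<close> holds and of the false ones otherwise. With \<open>b\<close> the
  polarity of \<open>L\<close>, making instances of \<open>L\<close> true always enlarges \<open>T\<close>.
\<close>

definition term_algebra :: "bool \<Rightarrow> ('f, 'p, 'v) atom set \<Rightarrow> ('f, 'p, ('f, 'v) trm) interp" where
  "term_algebra b T =
     \<lparr>universe = UNIV, fun_interp = Fun, pred_interp = (\<lambda>p ts. (Pred p ts \<in> T) = b)\<rparr>"

lemma is_interpretation_term_algebra: "is_interpretation (term_algebra b T)"
  by (simp add: is_interpretation_def term_algebra_def)

lemma eval_trm_term_algebra: "eval_trm (term_algebra b T) \<tau> t = subst_trm \<tau> t"
  by (induction t) (auto simp: term_algebra_def)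

lemma eval_literal_term_algebra:
  fixes K :: "('f, 'p, 'v) literal" and T :: "('f, 'p, 'v) atom set"
  assumes "\<not> is_Eq (atom_of K)"
  shows "eval_literal (term_algebra b T) \<tau> K \<longleftrightarrow>
    (subst_atom \<tau> (atom_of K) \<in> T) = (is_Pos K = b)"
proof -
  have "eval_atom (term_algebra b T) \<tau> A \<longleftrightarrow> (subst_atom \<tau> A \<in> T) = b"
    if "\<not> is_Eq A" for A :: "('f, 'p, 'v) atom"
    using that
    by (cases A)
      (simp_all add: eval_trm_term_algebra[abs_def], simp add: term_algebra_def)
  then show ?thesis using assms by (cases K) auto
qed

lemma true_clause_term_algebra:
  "true_clause (term_algebra b T) C \<longleftrightarrow> (\<forall>\<tau>. \<exists>K \<in># C. eval_literal (term_algebra b T) \<tau> K)"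
  by (simp add: true_clause_def term_algebra_def)

section \<open>Passing from arbitrary models to the term algebra\<close>

lemma eval_trm_in_universe:
  assumes "is_interpretation I" "range \<beta> \<subseteq> universe I"
  shows "eval_trm I \<beta> t \<in> universe I"
proof (induction t)
  case (Var x)
  then show ?case using assms(2) by auto
next
  case (Fun f ts)
  then have "set (map (eval_trm I \<beta>) ts) \<subseteq> universe I" by auto
  then show ?case using assms(1) unfolding is_interpretation_def eval_trm.simps by blast
qed

lemma eval_trm_subst_trm:
  "eval_trm I \<beta> (subst_trm \<tau> t) = eval_trm I (\<lambda>x. eval_trm I \<beta> (\<tau> x)) t"
  by (induction t) (auto simp: comp_def cong: map_cong)

lemma eval_atom_subst_atom:
  "eval_atom I \<beta> (subst_atom \<tau> A) = eval_atom I (\<lambda>x. eval_trm I \<beta> (\<tau> x)) A"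
  by (cases A) (auto simp: eval_trm_subst_trm comp_def)

lemma eval_literal_subst_literal:
  "eval_literal I \<beta> (subst_literal \<tau> L) = eval_literal I (\<lambda>x. eval_trm I \<beta> (\<tau> x)) L"
  by (cases L) (auto simp: eval_atom_subst_atom)

text \<open>Pull the model back along evaluation under a fixed \<open>\<beta>\<close>: a
  substitution \<open>\<tau>\<close> then acts as the assignment evaluating each
  \<open>\<tau> x\<close>. Equality must be absent because evaluation may identify distinct
  terms.\<close>

lemma term_algebra_model_exists:
  fixes F :: "('f, 'p, 'v) clause set"
  assumes eq: "equality_free F" and "satisfiable F"
  shows "\<exists>T :: ('f, 'p, 'v) atom set. models (term_algebra b T) F"
proof -
  obtain I :: "('f, 'p, ('f, 'v) trm) interp" where I: "is_interpretation I" "models I F"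
    using \<open>satisfiable F\<close> unfolding satisfiable_def by blast
  then obtain d where "d \<in> universe I" unfolding is_interpretation_def by auto
  \<comment> \<open>Variables are elements of the term algebra and need some value; any
    \<open>d\<close> in the universe will do.\<close>
  define \<beta> where "\<beta> = (\<lambda>_ :: 'v. d)"
  have \<beta>: "range \<beta> \<subseteq> universe I" using \<open>d \<in> universe I\<close> by (auto simp: \<beta>_def)
  define T :: "('f, 'p, 'v) atom set" where "T = {A. eval_atom I \<beta> A = b}"
  have "\<exists>K \<in># D. eval_literal (term_algebra b T) \<tau> K" if D: "D \<in> F" for D \<tau>
  proof -
    have "range (\<lambda>x. eval_trm I \<beta> (\<tau> x)) \<subseteq> universe I"
      using eval_trm_in_universe[OF I(1) \<beta>] by blast
    then obtain K where K: "K \<in># D" "eval_literal I (\<lambda>x. eval_trm I \<beta> (\<tau> x)) K"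
      using I(2) D unfolding models_def true_clause_def by blast
    have "\<not> is_Eq (atom_of K)" using eq D K(1) unfolding equality_free_def by blast
    then have "eval_literal (term_algebra b T) \<tau> K"
      using K(2) unfolding eval_literal_term_algebra[OF \<open>\<not> is_Eq (atom_of K)\<close>] T_def
      by (cases K) (auto simp: eval_atom_subst_atom)
    with K(1) show ?thesis by blast
  qed
  then show ?thesis unfolding models_def true_clause_term_algebra by blast
qed

text \<open>A clause instance sees only finitely many atoms, and on these the union agrees with a
  single large enough member of the chain.\<close>

lemma models_term_algebra_Union_chain:
  fixes F :: "('f, 'p, 'v) clause set" and \<T> :: "('f, 'p, 'v) atom set set"
  assumes eq: "equality_free F"
    and chain: "subset.chain {T. models (term_algebra b T) F} \<T>" "\<T> \<noteq> {}"
  shows "models (term_algebra b (\<Union>\<T>)) F"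
proof -
  have "\<exists>K \<in># D. eval_literal (term_algebra b (\<Union>\<T>)) \<tau> K" if D: "D \<in> F" for D \<tau>
  proof -
    define As where "As = (\<lambda>K. subst_atom \<tau> (atom_of K)) ` set_mset D"
    have "finite (As \<inter> \<Union>\<T>)" by (simp add: As_def)
    then obtain T where T: "T \<in> \<T>" "As \<inter> \<Union>\<T> \<subseteq> T"
      using finite_subset_Union_chain[OF _ _ chain(2,1)] by blast
    then have "models (term_algebra b T) F" using chain(1) unfolding subset.chain_def by blast
    then obtain K where K: "K \<in># D" "eval_literal (term_algebra b T) \<tau> K"
      using D unfolding models_def true_clause_term_algebra by blast
    have "\<not> is_Eq (atom_of K)" using eq D K(1) unfolding equality_free_def by blast
    note eval = eval_literal_term_algebra[OF this]
    have "subst_atom \<tau> (atom_of K) \<in> As" using K(1) by (simp add: As_def)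
    then have "subst_atom \<tau> (atom_of K) \<in> T \<longleftrightarrow> subst_atom \<tau> (atom_of K) \<in> \<Union>\<T>"
      using T by blast
    with K show ?thesis using eval by metis
  qed
  then show ?thesis unfolding models_def true_clause_term_algebra by blast
qed

lemma maximal_term_algebra_model_exists:
  fixes F :: "('f, 'p, 'v) clause set"
  assumes "equality_free F" "satisfiable F"
  shows "\<exists>T :: ('f, 'p, 'v) atom set. models (term_algebra b T) F \<and>
    (\<forall>T'. models (term_algebra b T') F \<longrightarrow> T \<subseteq> T' \<longrightarrow> T' = T)"
proof -
  define \<M> :: "('f, 'p, 'v) atom set set" where "\<M> = {T. models (term_algebra b T) F}"
  have "\<M> \<noteq> {}" using term_algebra_model_exists[OF assms] by (simp add: \<M>_def)
  moreover have "\<Union>\<T> \<in> \<M>" if "\<T> \<noteq> {}" "subset.chain \<M> \<T>" for \<T>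
    using models_term_algebra_Union_chain[OF assms(1)] that by (simp add: \<M>_def)
  ultimately have "\<exists>T \<in> \<M>. \<forall>T' \<in> \<M>. T \<subseteq> T' \<longrightarrow> T' = T" by (rule subset_Zorn_nonempty)
  then show ?thesis by (simp add: \<M>_def)
qed


section \<open>Blocked clauses\<close>

lemma subst_atom_cong:
  "(\<And>x. x \<in> vars_atom A \<Longrightarrow> \<sigma> x = \<tau> x) \<Longrightarrow> subst_atom \<sigma> A = subst_atom \<tau> A"
  by (cases A) (auto intro: subst_trm_cong)

lemma subst_literal_cong:
  "(\<And>x. x \<in> vars_literal L \<Longrightarrow> \<sigma> x = \<tau> x) \<Longrightarrow> subst_literal \<sigma> L = subst_literal \<tau> L"
  by (cases L) (auto intro: subst_atom_cong)

lemma subst_literal_complement: "subst_literal \<sigma> (complement L) = complement (subst_literal \<sigma> L)"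
  by (cases L) auto

lemma complement_complement: "complement (complement L) = L"
  by (cases L) auto

lemma is_Pos_subst_literal: "is_Pos (subst_literal \<sigma> L) = is_Pos L"
  by (cases L) auto

lemma atom_of_subst_literal: "atom_of (subst_literal \<sigma> L) = subst_atom \<sigma> (atom_of L)"
  by (cases L) auto

lemma eq_complement_iff: "K = complement L \<longleftrightarrow> atom_of K = atom_of L \<and> is_Pos K \<noteq> is_Pos L"
  by (cases K; cases L) auto

text \<open>Truth depends only on the instance, so literals with equal instances under different
  substitutions can be exchanged.\<close>

lemma eval_literal_term_algebra_subst:
  "eval_literal (term_algebra b T) \<tau> L = eval_literal (term_algebra b T) Var (subst_literal \<tau> L)"
  by (simp add: eval_literal_subst_literal eval_trm_term_algebra subst_trm_Var)

text \<open>
  The two instances may use different substitutions; variable disjointness merges them into one.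
\<close>

lemma blocked_by_resolvent_instance_true:
  fixes F :: "('f, 'p, 'v) clause set" and T :: "('f, 'p, 'v) atom set"
  assumes blocked: "blocked_by L C F" and D: "D \<in> F" "D \<noteq> C"
    and disj: "vars_clause C \<inter> vars_clause D = {}"
    and N: "K\<^sub>0 \<in># D" "subst_literal \<rho> K\<^sub>0 = complement (subst_literal \<tau> L)"
  shows "(\<exists>K \<in># C - {#L#}. eval_literal (term_algebra b T) \<tau> K) \<or>
    (\<exists>K \<in># D. subst_literal \<rho> K \<noteq> complement (subst_literal \<tau> L) \<and>
       eval_literal (term_algebra b T) \<rho> K)"
proof -
  let ?I = "term_algebra b T"
  \<comment> \<open>\<open>P\<close> selects all literals to resolve upon, so that none with this
    instance survives in the resolvent.\<close>
  define P where "P K \<longleftrightarrow> subst_literal \<rho> K = complement (subst_literal \<tau> L)" for K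
  define C' where "C' = C - {#L#}"
  have C: "C = {#L#} + C'" using blocked by (simp add: C'_def blocked_by_def)
  have D_split: "D = filter_mset P D + filter_mset (\<lambda>K. \<not> P K) D"
    by (rule multiset_partition)
  define \<theta> where "\<theta> x = (if x \<in> vars_clause C then \<tau> x else \<rho> x)" for x
  have \<theta>C: "subst_literal \<theta> K = subst_literal \<tau> K" if "K \<in># C" for K
    using that by (intro subst_literal_cong) (auto simp: \<theta>_def vars_clause_def)
  have \<theta>D: "subst_literal \<theta> K = subst_literal \<rho> K" if "K \<in># D" for K
    using that disj by (intro subst_literal_cong) (auto simp: \<theta>_def vars_clause_def)
  define Ls where "Ls = insert L (complement ` set_mset (filter_mset P D))"
  \<comment> \<open>The merged \<open>\<theta>\<close> collapses \<open>L\<close> and the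
    complements of the selected literals to one literal, so an mgu exists and
    \<open>\<theta>\<close> factors through it.\<close>
  have "subst_literal \<theta> K = subst_literal \<tau> L" if "K \<in> Ls" for K
    using that \<theta>C \<theta>D C
    by (auto simp: Ls_def P_def subst_literal_complement complement_complement)
  then have "unifier \<theta> Ls" by (auto simp: unifier_def)
  moreover have "finite Ls" by (simp add: Ls_def)
  ultimately obtain \<sigma> where \<sigma>: "mgu \<sigma> Ls" using mgu_exists by blast
  with \<open>unifier \<theta> Ls\<close> obtain \<delta> where \<delta>: "\<And>x. \<theta> x = subst_trm \<delta> (\<sigma> x)"
    unfolding mgu_def by blast
  define R where "R = subst_clause \<sigma> C' + subst_clause \<sigma> (filter_mset (\<lambda>K. \<not> P K) D)"
  have "filter_mset P D \<noteq> {#}" using N by (auto simp: P_def filter_mset_eq_conv)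
  then have "L_resolvent L C D R"
    unfolding L_resolvent_def using disj C D_split \<sigma> unfolding Ls_def R_def by blast
  then have "valid R" using blocked D unfolding blocked_by_def by blast
  then have "true_clause ?I R" using is_interpretation_term_algebra unfolding valid_def by blast
  then obtain K where "K \<in># R" "eval_literal ?I \<delta> K"
    unfolding true_clause_term_algebra by blast
  then obtain K where K: "K \<in># C' \<or> K \<in># D \<and> \<not> P K" "eval_literal ?I \<delta> (subst_literal \<sigma> K)"
    unfolding R_def subst_clause_def by auto
  \<comment> \<open>The \<open>\<delta>\<close>-instance of the resolvent consists of
    \<open>\<theta>\<close>-instances of literals of the parents.\<close>
  have "eval_literal ?I \<theta> K"
    using K(2) unfolding eval_literal_subst_literal eval_trm_term_algebra \<delta>[symmetric] .
  moreover have "K \<in># C' \<Longrightarrow> K \<in># C" using C by simp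
  ultimately show ?thesis
    using K(1) \<theta>C \<theta>D unfolding C'_def[symmetric] P_def
    by (metis eval_literal_term_algebra_subst)
qed

lemma models_blocked_clause_of_maximal:
  fixes F :: "('f, 'p, 'v) clause set" and T :: "('f, 'p, 'v) atom set"
  assumes blocked: "blocked_by L C F"
    and disj: "variable_disjoint (F \<union> {C})"
    and eq: "equality_free (F \<union> {C})"
    and model: "models (term_algebra (is_Pos L) T) (F - {C})"
    and maximal: "\<And>T'. models (term_algebra (is_Pos L) T') (F - {C}) \<Longrightarrow> T \<subseteq> T' \<Longrightarrow> T' = T"
  shows "true_clause (term_algebra (is_Pos L) T) C"
proof (rule ccontr)
  let ?I = "term_algebra (is_Pos L)"
  assume "\<not> true_clause (?I T) C"
  then obtain \<tau> where \<tau>: "\<And>K. K \<in># C \<Longrightarrow> \<not> eval_literal (?I T) \<tau> K"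
    unfolding true_clause_term_algebra by blast
  have L: "L \<in># C" using blocked unfolding blocked_by_def by blast
  have noEq: "\<not> is_Eq (atom_of K)" if "K \<in># D" "D \<in> F \<union> {C}" for K D
    using eq that unfolding equality_free_def by blast
  define A where "A = subst_atom \<tau> (atom_of L)"
  \<comment> \<open>With \<open>b\<close> the polarity of \<open>L\<close>, membership of
    \<open>A\<close> in \<open>T\<close> would make the instance of \<open>L\<close> true.\<close>
  have "A \<notin> T"
    using \<tau>[OF L] eval_literal_term_algebra[of L, OF noEq[OF L]] by (simp add: A_def)
  then have "\<not> models (?I (insert A T)) (F - {C})" using maximal[of "insert A T"] by blast
  then obtain D \<rho> where D: "D \<in> F" "D \<noteq> C"
    and \<rho>: "\<And>K. K \<in># D \<Longrightarrow> \<not> eval_literal (?I (insert A T)) \<rho> K"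
    unfolding models_def true_clause_term_algebra by blast
  have flipped: "subst_literal \<rho> K = complement (subst_literal \<tau> L)"
    if K: "K \<in># D" "eval_literal (?I T) \<rho> K" for K
  proof -
    note eval = eval_literal_term_algebra[of K, OF noEq[OF K(1)]]
    \<comment> \<open>The insertion changes the truth value of \<open>A\<close> alone, in favour of
      the polarity of \<open>L\<close>; a literal that becomes false must have atom \<open>A\<close>
      and the opposite polarity.\<close>
    have "subst_atom \<rho> (atom_of K) = A \<and> is_Pos K \<noteq> is_Pos L"
      using K(2) \<rho>[OF K(1)] D(1) unfolding eval[OF UnI1, OF D(1)] by auto
    then show ?thesis
      by (simp add: eq_complement_iff atom_of_subst_literal is_Pos_subst_literal A_def)
  qed
  \<comment> \<open>\<open>D\<close> holds under \<open>T\<close>, which supplies at least one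
    literal to resolve upon.\<close>
  obtain K\<^sub>0 where K\<^sub>0: "K\<^sub>0 \<in># D" "eval_literal (?I T) \<rho> K\<^sub>0"
    using model D unfolding models_def true_clause_term_algebra by blast
  have "vars_clause C \<inter> vars_clause D = {}"
    using disj D unfolding variable_disjoint_def by blast
  \<comment> \<open>Neither alternative is possible: \<open>\<tau>\<close> falsifies all of
    \<open>C\<close>, and every literal of \<open>D\<close> true under \<open>\<rho>\<close> is a
    flipped one.\<close>
  from blocked_by_resolvent_instance_true[OF blocked D this K\<^sub>0(1) flipped[OF K\<^sub>0]]
  show False using \<tau> flipped by (meson in_diffD)
qed

theorem theorem3:
  fixes F :: "('f, 'p, 'v) clause set" and C :: "('f, 'p, 'v) clause"
  assumes "is_cnf (F \<union> {C})"
    and "equality_free (F \<union> {C})"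
    and "blocked C F"
  shows "redundant C F"
  unfolding redundant_def sat_equivalent_def
proof
  assume "satisfiable (F \<union> {C})"
  then show "satisfiable (F - {C})" unfolding satisfiable_def models_def by blast
next
  assume sat: "satisfiable (F - {C})"
  \<comment> \<open>The blocking literal comes first, since its polarity fixes the order in which
    the model is taken maximal.\<close>
  obtain L where L: "blocked_by L C F" using assms(3) unfolding blocked_def by blast
  have "equality_free (F - {C})" using assms(2) unfolding equality_free_def by blast
  then obtain T :: "('f, 'p, 'v) atom set" where
    T: "models (term_algebra (is_Pos L) T) (F - {C})"
    and "\<forall>T'. models (term_algebra (is_Pos L) T') (F - {C}) \<longrightarrow> T \<subseteq> T' \<longrightarrow> T' = T"
    using maximal_term_algebra_model_exists[OF _ sat] by metis
  then have maximal: "T' = T"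
    if "models (term_algebra (is_Pos L) T') (F - {C})" "T \<subseteq> T'" for T'
    using that by simp
  have "variable_disjoint (F \<union> {C})" using assms(1) unfolding is_cnf_def by blast
  then have "true_clause (term_algebra (is_Pos L) T) C"
    using models_blocked_clause_of_maximal[OF L _ assms(2) T maximal] by simp
  then have "models (term_algebra (is_Pos L) T) (F \<union> {C})"
    using T unfolding models_def by blast
  then show "satisfiable (F \<union> {C})"
    using is_interpretation_term_algebra unfolding satisfiable_def by blast
qed

end
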